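(* Let $G$ be a $k$-regular balanced bipartite graph with parts $A,B$, $|A|=|B|=n$. Let $M$ be its bipartite incidence matrix and let $\lambda'$ be the second largest eigenvalue of $MM^T$. If $\lambda'\ne0$, then $\mathrm{box}(G)\ge\frac{k}{4\sqrt{\lambda'}}$.
   Context: With the vertices of $A$ and of $B$ each ordered, the bipartite incidence matrix is $M=[m_{ij}]$ with $m_{ij}=1$ if the $i$th vertex of $A$ is adjacent to the $j$th vertex of $B$ and $m_{ij}=0$ otherwise. The boxicity $\mathrm{box}(G)$ is the minimum $k$ such that there are interval graphs $I_1,\dots,I_k$ on $V(G)$ with $E(G)=E(I_1)\cap\cdots\cap E(I_k)$. *)

theory Defs
  imports
    Complex_Main
    "HOL-Library.Multiset"
    "HOL-Computational_Algebra.Polynomial"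
    "Graph_Theory.Graph_Theory"
    "Jordan_Normal_Form.Char_Poly"
begin

text \<open>
  Finite simple graphs are the \<^locale>\<open>pair_graph\<close>s of Graph_Theory: finite, loop-free, symmetric
  digraphs without parallel arcs. An edge joining u and v is represented by the two arcs
  (u,v) and (v,u), so \<^const>\<open>out_degree\<close> is the usual degree.
\<close>

definition regular :: "'a pair_pre_digraph \<Rightarrow> nat \<Rightarrow> bool" where
  "regular G k \<longleftrightarrow> (\<forall>v \<in> pverts G. out_degree (with_proj G) v = k)"

definition bipartition :: "'a pair_pre_digraph \<Rightarrow> 'a set \<Rightarrow> 'a set \<Rightarrow> bool" where
  "bipartition G A B \<longleftrightarrow> A \<union> B = pverts G \<and> A \<inter> B = {} \<and> parcs G \<subseteq> A \<times> B \<union> B \<times> A"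

definition interval_graph :: "'a pair_pre_digraph \<Rightarrow> bool" where
  "interval_graph H \<longleftrightarrow>
     (\<exists>l r :: 'a \<Rightarrow> real. (\<forall>v \<in> pverts H. l v \<le> r v) \<and>
        (\<forall>u v. (u, v) \<in> parcs H \<longleftrightarrow>
           u \<in> pverts H \<and> v \<in> pverts H \<and> u \<noteq> v \<and> {l u..r u} \<inter> {l v..r v} \<noteq> {}))"

text \<open>
  The edge set of G is the intersection of the edge sets of k interval graphs on the vertices of G.
  The intersection is taken within the set of all pairs of distinct vertices; this only matters
  for \<open>k = 0\<close>, where the empty intersection is the complete graph (so complete graphs, and no
  others, have boxicity 0).
\<close>

definition interval_cover :: "'a pair_pre_digraph \<Rightarrow> nat \<Rightarrow> (nat \<Rightarrow> 'a pair_pre_digraph) \<Rightarrow> bool" where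
  "interval_cover G k I \<longleftrightarrow>
     (\<forall>i<k. interval_graph (I i) \<and> pverts (I i) = pverts G) \<and>
     parcs G = {(u, v). u \<in> pverts G \<and> v \<in> pverts G \<and> u \<noteq> v} \<inter> (\<Inter>i<k. parcs (I i))"

definition boxicity :: "'a pair_pre_digraph \<Rightarrow> nat" where
  "boxicity G = (LEAST k. \<exists>I. interval_cover G k I)"

text \<open>The minimum exists: every non-adjacent pair a, b is separated by one interval graph.\<close>

lemma interval_cover_exists:
  assumes "pair_graph G"
  shows "\<exists>k I. interval_cover G k I"
proof -
  interpret pair_graph G by fact
  define N where "N = {(u, v). u \<in> pverts G \<and> v \<in> pverts G \<and> u \<noteq> v \<and> (u, v) \<notin> parcs G}"
  define J where "J = (\<lambda>(a, b). \<lparr>pverts = pverts G,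
     parcs = {(u, v). u \<in> pverts G \<and> v \<in> pverts G \<and> u \<noteq> v \<and> (u, v) \<noteq> (a, b) \<and> (u, v) \<noteq> (b, a)}\<rparr>)"
  have "N \<subseteq> pverts G \<times> pverts G" by (auto simp: N_def)
  then have "finite N"
    using pair_finite_verts finite_subset by blast
  then obtain f and k :: nat where f: "N = f ` {i. i < k}"
    by (auto simp: finite_conv_nat_seg_image)
  have "interval_graph (J p)" if p: "p \<in> N" for p
  proof -
    obtain a b where ab: "p = (a, b)" "a \<noteq> b" using p by (auto simp: N_def)
    show ?thesis
      unfolding interval_graph_def
      by (rule exI[of _ "\<lambda>v. if v = b then 2 else 0"], rule exI[of _ "\<lambda>v. if v = a then 1 else 2"])
        (use ab in \<open>auto simp: J_def\<close>)
  qed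
  moreover have "parcs G = {(u, v). u \<in> pverts G \<and> v \<in> pverts G \<and> u \<noteq> v} \<inter> (\<Inter>p\<in>N. parcs (J p))"
    using no_loops' arcs_symmetric in_arcsD1 in_arcsD2 by (fastforce simp: N_def J_def)
  moreover have "pverts (J p) = pverts G" for p by (cases p) (auto simp: J_def)
  ultimately have "interval_cover G k (J \<circ> f)"
    by (auto simp: interval_cover_def f lessThan_def)
  then show ?thesis by blast
qed

definition bip_incidence_mat :: "'a pair_pre_digraph \<Rightarrow> 'a list \<Rightarrow> 'a list \<Rightarrow> real mat" where
  "bip_incidence_mat G as bs =
     mat (length as) (length bs) (\<lambda>(i, j). if (as ! i, bs ! j) \<in> parcs G then 1 else 0)"

text \<open>
  The real eigenvalues in decreasing order, repeated according to (algebraic) multiplicity. For a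
  real symmetric matrix these are all the eigenvalues, and the two multiplicities agree.
  The second largest eigenvalue is meaningful for symmetric matrices of size at least 2; it
  coincides with the largest one if that is a multiple eigenvalue.
\<close>

definition eigenvalues_desc :: "real mat \<Rightarrow> real list" where
  "eigenvalues_desc A = rev (sorted_list_of_multiset (proots (char_poly A)))"

definition second_largest_eigenvalue :: "real mat \<Rightarrow> real" where
  "second_largest_eigenvalue A = eigenvalues_desc A ! 1"

end

theory Submission
  imports Defs "HOL-Analysis.Function_Topology"
begin

text \<open>
  If $X \subseteq A$ and $Y \subseteq B$ have no edge between them, then comparing the indicator
  vector of $X$, projected onto the orthogonal complement of the all-ones vector, with the Rayleigh
  bound for $M M^T$ gives $|X|\,|Y| \le s^2$ where $s = n \sqrt{\lambda'} / k$. In an interval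
  supergraph of $G$ the non-adjacent pairs $(a, b)$ whose intervals lie in the order $a$, $b$ form
  a staircase all of whose rectangles avoid the edges of $G$. Put $d = n - k$. The $i$-th longest
  row of the staircase has length at most both $d$ and $s^2/i$, hence at most $s \sqrt{d/i}$, and there are at
  most $d$ nonempty rows, so the staircase has at most $2sd$ elements. Each interval graph thus
  accounts for at most $4sd$ of the $nd$ non-edges between $A$ and $B$, which gives
  $n \le 4s \cdot \mathrm{box}(G)$.
\<close>

section \<open>Eigenvalues of symmetric matrices with constant row sums\<close>

text \<open>For small \<open>t\<close> the linear term dominates, so a nonzero \<open>a\<close>
  would make the expression negative for a suitable sign of \<open>t\<close>. This is the
  first-order optimality condition for a Rayleigh maximizer.\<close>

lemma linear_coefficient_eq_0:
  fixes a b :: real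
  assumes "\<And>t. 0 \<le> 2 * t * a + t\<^sup>2 * b"
  shows "a = 0"
proof (rule ccontr)
  assume "a \<noteq> 0"
  define \<beta> where "\<beta> = \<bar>b\<bar> + 1"
  have \<beta>: "\<beta> > 0" "b < \<beta>" by (auto simp: \<beta>_def)
  \<comment> \<open>The choice \<open>t = - a / \<beta>\<close> is small enough:
    \<open>b < \<beta>\<close> keeps the factor \<open>b / \<beta> - 2\<close> negative.\<close>
  have "0 \<le> 2 * (- a / \<beta>) * a + (- a / \<beta>)\<^sup>2 * b" by (rule assms)
  also have "\<dots> = a\<^sup>2 / \<beta> * (b / \<beta> - 2)"
    using \<beta> by (simp add: field_simps power2_eq_square)
  also have "\<dots> < 0"
    using \<beta> \<open>a \<noteq> 0\<close> by (intro mult_pos_neg) (auto simp: field_simps)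
  finally show False by simp
qed

text \<open>Vectors of variable length \<open>n\<close> are functions on \<open>nat\<close> that
  vanish from index \<open>n\<close> on. In the product topology the set is a closed part of a
  product of compact intervals and singletons, so Tychonoff applies.\<close>

lemma compact_sphere_sum_0:
  "compact {x :: nat \<Rightarrow> real. (\<forall>i\<ge>n. x i = 0) \<and> (\<Sum>i<n. x i) = 0 \<and> (\<Sum>i<n. (x i)\<^sup>2) = 1}"
    (is "compact ?K")
proof -
  define S :: "nat \<Rightarrow> real set" where "S = (\<lambda>i. if i < n then {-1..1} else {0})"
  have "compactin (product_topology (\<lambda>i. euclidean) UNIV) (PiE UNIV S)"
    by (subst compactin_PiE) (auto simp: S_def)
  then have 1: "compact (PiE UNIV S)"
    by (simp add: euclidean_product_topology)
  have "closed ({x :: nat \<Rightarrow> real. (\<Sum>i<n. x i) = 0} \<inter> {x. (\<Sum>i<n. (x i)\<^sup>2) = 1})"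
    by (intro closed_Int closed_Collect_eq continuous_intros)
       (simp_all add: continuous_on_product_coordinates)
  with 1 have "compact (PiE UNIV S \<inter> ({x :: nat \<Rightarrow> real. (\<Sum>i<n. x i) = 0} \<inter> {x. (\<Sum>i<n. (x i)\<^sup>2) = 1}))"
    by (rule compact_Int_closed)
  also have "PiE UNIV S \<inter> ({x :: nat \<Rightarrow> real. (\<Sum>i<n. x i) = 0} \<inter> {x. (\<Sum>i<n. (x i)\<^sup>2) = 1}) = ?K"
  proof (intro equalityI subsetI)
    fix x assume x: "x \<in> ?K"
    have "x i \<in> {-1..1}" if "i < n" for i
    proof -
      have "(x i)\<^sup>2 \<le> (\<Sum>i<n. (x i)\<^sup>2)"
        using that by (intro member_le_sum) auto
      then have "\<bar>x i\<bar> \<le> 1" using x by (simp add: abs_square_le_1)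
      then show ?thesis by auto
    qed
    then show "x \<in> PiE UNIV S \<inter> ({x :: nat \<Rightarrow> real. (\<Sum>i<n. x i) = 0} \<inter> {x. (\<Sum>i<n. (x i)\<^sup>2) = 1})"
      using x by (auto simp: S_def PiE_def)
  next
    fix x assume x: "x \<in> PiE UNIV S \<inter> ({x :: nat \<Rightarrow> real. (\<Sum>i<n. x i) = 0} \<inter> {x. (\<Sum>i<n. (x i)\<^sup>2) = 1})"
    then have "x i \<in> S i" for i by (meson IntD1 PiE_mem UNIV_I)
    then have "x i = 0" if "i \<ge> n" for i
      using that by (metis S_def leD singletonD)
    then show "x \<in> ?K" using x by simp
  qed
  finally show ?thesis .
qed

text \<open>Symmetry and constant row sums make the sum-zero hyperplane invariant, so a maximizer of
  the quadratic form on its unit sphere is an eigenvector, and its eigenvalue is the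
  maximum.\<close>

lemma sum_0_Rayleigh_maximizer:
  fixes c :: "nat \<Rightarrow> nat \<Rightarrow> real"
  assumes "n \<ge> 2"
    and sym: "\<And>i j. i < n \<Longrightarrow> j < n \<Longrightarrow> c i j = c j i"
    and row: "\<And>i. i < n \<Longrightarrow> (\<Sum>j<n. c i j) = r"
  obtains \<mu> v where "\<exists>i<n. v i \<noteq> 0" "(\<Sum>i<n. v i) = 0"
    "\<And>i. i < n \<Longrightarrow> (\<Sum>j<n. c i j * v j) = \<mu> * v i"
    "\<And>x. (\<Sum>i<n. x i) = 0 \<Longrightarrow> (\<Sum>i<n. \<Sum>j<n. c i j * x i * x j) \<le> \<mu> * (\<Sum>i<n. (x i)\<^sup>2)"
proof -
  define K :: "(nat \<Rightarrow> real) set"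
    where "K = {x. (\<forall>i\<ge>n. x i = 0) \<and> (\<Sum>i<n. x i) = 0 \<and> (\<Sum>i<n. (x i)\<^sup>2) = 1}"
  define Q where "Q x = (\<Sum>i<n. \<Sum>j<n. c i j * x i * x j)" for x :: "nat \<Rightarrow> real"
  have K_scale: "(\<lambda>i. if i < n then x i / sqrt (\<Sum>i<n. (x i)\<^sup>2) else 0) \<in> K"
    if "(\<Sum>i<n. x i) = 0" "(\<Sum>i<n. (x i)\<^sup>2) > 0" for x
    using that
    by (simp add: K_def sum_divide_distrib[symmetric] power_divide sum_nonneg)
  have "K \<noteq> {}"
  proof -
    \<comment> \<open>The difference of the first two unit vectors; this is where
      \<open>n \<ge> 2\<close> enters.\<close>
    define x :: "nat \<Rightarrow> real" where "x = (\<lambda>i. if i = 0 then 1 else if i = 1 then -1 else 0)"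
    have n: "{..<n} = insert 0 (insert 1 {2..<n})" using assms(1) by auto
    have "(\<Sum>i<n. x i) = 0" "(\<Sum>i<n. (x i)\<^sup>2) > 0"
      unfolding n by (simp_all add: x_def)
    from K_scale[OF this] show ?thesis by blast
  qed
  moreover have "continuous_on K Q"
    unfolding Q_def
    by (intro continuous_intros) (auto intro: continuous_on_subset[OF continuous_on_product_coordinates])
  moreover have "compact K"
    unfolding K_def by (rule compact_sphere_sum_0)
  ultimately obtain v where v: "v \<in> K" and max: "\<And>y. y \<in> K \<Longrightarrow> Q y \<le> Q v"
    using continuous_attains_sup[of K Q] by blast
  define \<mu> where "\<mu> = Q v"
  have v_sum: "(\<Sum>i<n. v i) = 0" and v_norm: "(\<Sum>i<n. (v i)\<^sup>2) = 1"
    using v by (auto simp: K_def)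
  have bound: "Q x \<le> \<mu> * (\<Sum>i<n. (x i)\<^sup>2)" if "(\<Sum>i<n. x i) = 0" for x
  proof (cases "(\<Sum>i<n. (x i)\<^sup>2) = 0")
    case True
    then have "x i = 0" if "i < n" for i
      using that by (simp add: sum_nonneg_eq_0_iff)
    then have "Q x = 0" by (simp add: Q_def)
    with True show ?thesis by simp
  next
    case False
    define s where "s = (\<Sum>i<n. (x i)\<^sup>2)"
    have s: "s > 0" using False by (simp add: s_def sum_nonneg order_less_le)
    have "Q (\<lambda>i. if i < n then x i / sqrt s else 0) \<le> \<mu>"
      unfolding \<mu>_def s_def by (rule max[OF K_scale[OF that s[unfolded s_def]]])
    also have "Q (\<lambda>i. if i < n then x i / sqrt s else 0) = Q x / s"
      using s by (simp add: Q_def sum_divide_distrib)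
    finally show ?thesis using s by (simp add: field_simps s_def)
  qed
  \<comment> \<open>The residual of the eigenvalue equation has sum zero, so
    \<open>v + t * w\<close> stays in the hyperplane. The Rayleigh bound there has linear
    coefficient twice the squared norm of \<open>w\<close>, which must therefore vanish.\<close>
  define w where "w i = \<mu> * v i - (\<Sum>j<n. c i j * v j)" for i
  have w_sum: "(\<Sum>i<n. w i) = 0"
  proof -
    have "(\<Sum>i<n. \<Sum>j<n. c i j * v j) = (\<Sum>j<n. \<Sum>i<n. c j i * v j)"
      by (subst sum.swap) (auto intro!: sum.cong simp: sym)
    also have "\<dots> = (\<Sum>j<n. r * v j)"
      by (auto intro!: sum.cong simp: row sum_distrib_right[symmetric])
    also have "\<dots> = 0" by (simp add: sum_distrib_left[symmetric] v_sum)
    finally show ?thesis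
      by (simp add: w_def sum_subtractf sum_distrib_left[symmetric] v_sum)
  qed
  define b where "b = \<mu> * (\<Sum>i<n. (w i)\<^sup>2) - Q w"
  have "0 \<le> 2 * t * (\<Sum>i<n. (w i)\<^sup>2) + t\<^sup>2 * b" for t
  proof -
    have cross: "(\<Sum>i<n. \<Sum>j<n. c i j * v i * w j) = (\<Sum>i<n. \<Sum>j<n. c i j * w i * v j)"
      by (subst sum.swap) (auto intro!: sum.cong simp: sym)
    have "Q (\<lambda>i. v i + t * w i)
        = Q v + t * (\<Sum>i<n. \<Sum>j<n. c i j * v i * w j) + t * (\<Sum>i<n. \<Sum>j<n. c i j * w i * v j) + t\<^sup>2 * Q w"
      by (simp add: Q_def algebra_simps sum.distrib sum_distrib_left power2_eq_square)
    also have "\<dots> = \<mu> + 2 * t * (\<Sum>i<n. w i * (\<Sum>j<n. c i j * v j)) + t\<^sup>2 * Q w"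
      unfolding cross by (simp add: \<mu>_def sum_distrib_left mult_ac)
    finally have 1: "Q (\<lambda>i. v i + t * w i) = \<dots>" .
    have 2: "(\<Sum>i<n. (v i + t * w i)\<^sup>2) = 1 + 2 * t * (\<Sum>i<n. w i * v i) + t\<^sup>2 * (\<Sum>i<n. (w i)\<^sup>2)"
      unfolding v_norm[symmetric]
      by (simp add: power2_eq_square algebra_simps sum.distrib sum_distrib_left)
    have 3: "(\<Sum>i<n. (w i)\<^sup>2) = \<mu> * (\<Sum>i<n. w i * v i) - (\<Sum>i<n. w i * (\<Sum>j<n. c i j * v j))"
      unfolding sum_distrib_left[of \<mu>] sum_subtractf[symmetric]
      by (rule sum.cong) (auto simp: w_def power2_eq_square algebra_simps)
    have "(\<Sum>i<n. v i + t * w i) = 0"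
      by (simp add: sum.distrib v_sum w_sum sum_distrib_left[symmetric])
    from bound[OF this] have "\<mu> + 2 * t * (\<Sum>i<n. w i * (\<Sum>j<n. c i j * v j)) + t\<^sup>2 * Q w
        \<le> \<mu> * (1 + 2 * t * (\<Sum>i<n. w i * v i) + t\<^sup>2 * (\<Sum>i<n. (w i)\<^sup>2))"
      by (simp only: 1 2)
    then have "0 \<le> 2 * t * (\<mu> * (\<Sum>i<n. w i * v i) - (\<Sum>i<n. w i * (\<Sum>j<n. c i j * v j))) + t\<^sup>2 * b"
      unfolding b_def right_diff_distrib distrib_left by (simp add: mult_ac)
    then show ?thesis by (simp only: 3)
  qed
  then have "(\<Sum>i<n. (w i)\<^sup>2) = 0" by (rule linear_coefficient_eq_0)
  then have "w i = 0" if "i < n" for i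
    using that by (simp add: sum_nonneg_eq_0_iff)
  then have "(\<Sum>j<n. c i j * v j) = \<mu> * v i" if "i < n" for i
    using that by (simp add: w_def)
  moreover have "\<exists>i<n. v i \<noteq> 0"
    using v_norm by (metis (no_types, lifting) lessThan_iff power_zero_numeral sum.neutral zero_neq_one)
  ultimately show ?thesis
    by (intro that[of v \<mu>] v_sum bound[unfolded Q_def])
qed

section \<open>Characteristic polynomials of matrices with constant row sums\<close>

text \<open>
  Changing the first basis vector to the all-ones eigenvector block-triangularises the matrix. This
  counts the row sum as an eigenvalue even when it coincides with one of the remaining block.
\<close>
lemma char_poly_constant_row_sums:
  fixes c :: "nat \<Rightarrow> nat \<Rightarrow> real"
  assumes row: "\<And>i. i < Suc m \<Longrightarrow> (\<Sum>j<Suc m. c i j) = r"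
  shows "char_poly (mat (Suc m) (Suc m) (\<lambda>(i, j). c i j)) =
    [:-r, 1:] * char_poly (mat m m (\<lambda>(i, j). c (Suc i) (Suc j) - c 0 (Suc j)))"
proof -
  define A where "A = mat (Suc m) (Suc m) (\<lambda>(i, j). c i j)"
  \<comment> \<open>\<open>P\<close> is the identity with its first column replaced by all ones,
    \<open>Q\<close> is its inverse, and \<open>B\<close> will be \<open>Q * A * P\<close>.\<close>
  define P :: "real mat" where "P = mat (Suc m) (Suc m) (\<lambda>(i, j). if i = j \<or> j = 0 then 1 else 0)"
  define Q :: "real mat"
    where "Q = mat (Suc m) (Suc m) (\<lambda>(i, j). if i = j then 1 else if j = 0 then -1 else 0)"
  define R where "R = mat 1 1 (\<lambda>_. r)"
  define C where "C = mat m m (\<lambda>(i, j). c (Suc i) (Suc j) - c 0 (Suc j))"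
  define B where "B = four_block_mat R (mat 1 m (\<lambda>(i, j). c 0 (Suc j))) (0\<^sub>m m 1) C"
  have carrier [simp]: "A \<in> carrier_mat (Suc m) (Suc m)" "P \<in> carrier_mat (Suc m) (Suc m)"
    "Q \<in> carrier_mat (Suc m) (Suc m)" "B \<in> carrier_mat (Suc m) (Suc m)"
    by (auto simp: A_def P_def Q_def B_def R_def C_def)
  have P_mult: "(P * X) $$ (i, j) = X $$ (0, j) + (if i = 0 then 0 else X $$ (i, j))"
    if X: "X \<in> carrier_mat (Suc m) (Suc m)" and ij: "i < Suc m" "j < Suc m" for X i j
  proof -
    have "(P * X) $$ (i, j) = (\<Sum>k<Suc m. P $$ (i, k) * X $$ (k, j))"
      using X ij by (simp add: P_def scalar_prod_def atLeast0LessThan del: sum.lessThan_Suc)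
    also have "\<dots> = (\<Sum>k<Suc m. (if k = 0 then X $$ (0, j) else 0) + (if k = i then if i = 0 then 0 else X $$ (i, j) else 0))"
      using ij by (intro sum.cong) (auto simp: P_def)
    also have "\<dots> = X $$ (0, j) + (if i = 0 then 0 else X $$ (i, j))"
      using ij by (subst sum.distrib) (simp del: sum.lessThan_Suc)
    finally show ?thesis .
  qed
  have PQ: "P * Q = 1\<^sub>m (Suc m)"
  proof (rule eq_matI)
    fix i j assume "i < dim_row (1\<^sub>m (Suc m) :: real mat)" "j < dim_col (1\<^sub>m (Suc m) :: real mat)"
    then show "(P * Q) $$ (i, j) = 1\<^sub>m (Suc m) $$ (i, j)"
      by (simp add: P_mult) (auto simp: Q_def)
  qed (auto simp: P_def Q_def)
  then have QP: "Q * P = 1\<^sub>m (Suc m)"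
    by (rule mat_mult_left_right_inverse[rotated 2]) simp_all
  have B_index: "B $$ (i, j) = (if j = 0 then if i = 0 then r else 0
      else c i j - (if i = 0 then 0 else c 0 j))" if "i < Suc m" "j < Suc m" for i j
    using that by (auto simp: B_def R_def C_def)
  have "A * P = P * B"
  proof (rule eq_matI)
    fix i j assume "i < dim_row (P * B)" "j < dim_col (P * B)"
    then have ij: "i < Suc m" "j < Suc m" by (auto simp: P_def B_def R_def C_def)
    have "(A * P) $$ (i, j) = (if j = 0 then r else c i j)"
    proof (cases "j = 0")
      case True
      have "(A * P) $$ (i, j) = (\<Sum>k<Suc m. c i k)"
        using ij True by (simp add: A_def P_def index_mult_mat scalar_prod_def atLeast0LessThan)
      then show ?thesis using True row[OF ij(1)] by simp
    next
      case False
      have "(A * P) $$ (i, j) = (\<Sum>k<Suc m. if k = j then c i k else 0)"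
        using ij False
        by (simp add: A_def P_def index_mult_mat scalar_prod_def atLeast0LessThan
            if_distrib[of "\<lambda>x. _ * x"] del: sum.lessThan_Suc cong: if_cong)
      then show ?thesis using False ij by simp
    qed
    also have "\<dots> = B $$ (0, j) + (if i = 0 then 0 else B $$ (i, j))"
      using ij by (simp add: B_index)
    also have "\<dots> = (P * B) $$ (i, j)"
      using ij by (simp add: P_mult)
    finally show "(A * P) $$ (i, j) = (P * B) $$ (i, j)" .
  qed (auto simp: A_def P_def B_def R_def C_def)
  then have "P * B * Q = A * (P * Q)"
    by (metis assoc_mult_mat carrier(1-3))
  then have "A = P * B * Q" by (simp add: PQ right_mult_one_mat[OF carrier(1)])
  then have "similar_mat A B"
    by (rule similar_matI[OF _ PQ QP, rotated]) (simp only: carrier insert_subset empty_subsetI simp_thms)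
  then have "char_poly A = char_poly B" by (rule char_poly_similar)
  also have "\<dots> = char_poly R * char_poly C"
    unfolding B_def by (rule char_poly_four_block_zeros_col) (auto simp: R_def C_def)
  also have "char_poly R = [:-r, 1:]"
    by (simp add: R_def char_poly_def char_poly_matrix_def det_single)
  finally show ?thesis by (simp add: A_def C_def)
qed

lemma char_poly_neq_0:
  assumes "A \<in> carrier_mat n n"
  shows "char_poly (A :: 'a :: comm_ring_1 mat) \<noteq> 0"
  using degree_monic_char_poly[OF assms] by auto

lemma proots_char_poly_constant_row_sums:
  fixes c :: "nat \<Rightarrow> nat \<Rightarrow> real"
  assumes row: "\<And>i. i < Suc m \<Longrightarrow> (\<Sum>j<Suc m. c i j) = r"
  shows "proots (char_poly (mat (Suc m) (Suc m) (\<lambda>(i, j). c i j))) =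
    add_mset r (proots (char_poly (mat m m (\<lambda>(i, j). c (Suc i) (Suc j) - c 0 (Suc j)))))"
proof -
  have "char_poly (mat m m (\<lambda>(i, j). c (Suc i) (Suc j) - c 0 (Suc j))) \<noteq> 0"
    by (rule char_poly_neq_0[of _ m]) simp
  then have "proots ([:-r, 1:] * char_poly (mat m m (\<lambda>(i, j). c (Suc i) (Suc j) - c 0 (Suc j)))) =
    add_mset r (proots (char_poly (mat m m (\<lambda>(i, j). c (Suc i) (Suc j) - c 0 (Suc j)))))"
    by (subst proots_mult) auto
  then show ?thesis using char_poly_constant_row_sums[of m c r, OF row] by simp
qed

text \<open>Modulo the all-ones vector, \<open>v\<close> becomes the vector of differences
  \<open>v (Suc i) - v 0\<close>, an eigenvector of the block left after splitting off
  \<open>r\<close>. It is nonzero because a constant vector with sum zero is zero. Two roots are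
  thus counted even if \<open>r = \<mu>\<close>.\<close>

lemma eigenvalue_constant_row_sums:
  fixes c :: "nat \<Rightarrow> nat \<Rightarrow> real"
  assumes row: "\<And>i. i < Suc m \<Longrightarrow> (\<Sum>j<Suc m. c i j) = r"
    and v: "\<exists>i<Suc m. v i \<noteq> 0" "(\<Sum>i<Suc m. v i) = 0"
    and eig: "\<And>i. i < Suc m \<Longrightarrow> (\<Sum>j<Suc m. c i j * v j) = \<mu> * v i"
  shows "{#r, \<mu>#} \<subseteq># proots (char_poly (mat (Suc m) (Suc m) (\<lambda>(i, j). c i j)))"
proof -
  define C where "C = mat m m (\<lambda>(i, j). c (Suc i) (Suc j) - c 0 (Suc j))"
  define u where "u = vec m (\<lambda>i. v (Suc i) - v 0)"
  have C: "C \<in> carrier_mat m m" by (simp add: C_def)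
  have "u \<noteq> 0\<^sub>v m"
  proof
    assume u: "u = 0\<^sub>v m"
    have "v (Suc i) = v 0" if "i < m" for i
      using arg_cong[OF u, of "\<lambda>w. w $ i"] that by (simp add: u_def)
    then have eq: "v i = v 0" if "i < Suc m" for i
      using that by (cases i) auto
    have "(\<Sum>i<Suc m. v i) = (\<Sum>i<Suc m. v 0)" by (rule sum.cong[OF refl]) (rule eq, simp)
    with v(2) have "real (Suc m) * v 0 = 0" by (simp only: sum_constant card_lessThan)
    then have "v 0 = 0" by (simp only: mult_eq_0_iff of_nat_eq_0_iff) simp
    with eq v(1) show False by metis
  qed
  moreover have "C *\<^sub>v u = \<mu> \<cdot>\<^sub>v u"
  proof (rule eq_vecI)
    fix i assume "i < dim_vec (\<mu> \<cdot>\<^sub>v u)"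
    then have i: "i < m" by (simp add: u_def)
    have "(C *\<^sub>v u) $ i = (\<Sum>j<m. (c (Suc i) (Suc j) - c 0 (Suc j)) * (v (Suc j) - v 0))"
      using i by (simp add: C_def u_def scalar_prod_def atLeast0LessThan)
    \<comment> \<open>The added term at index 0 vanishes, since its factor is
      \<open>v 0 - v 0\<close>.\<close>
    also have "\<dots> = (\<Sum>j<Suc m. (c (Suc i) j - c 0 j) * (v j - v 0))"
      by (simp del: sum.lessThan_Suc add: sum.lessThan_Suc_shift)
    also have "\<dots> = (\<Sum>j<Suc m. c (Suc i) j * v j) - (\<Sum>j<Suc m. c 0 j * v j)
        - ((\<Sum>j<Suc m. c (Suc i) j) - (\<Sum>j<Suc m. c 0 j)) * v 0"
      by (simp del: sum.lessThan_Suc add: algebra_simps sum.distrib sum_subtractf sum_distrib_left)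
    also have "\<dots> = \<mu> * (v (Suc i) - v 0)"
      using i eig[of "Suc i"] eig[of 0] row[of "Suc i"] row[of 0]
      by (simp del: sum.lessThan_Suc add: right_diff_distrib)
    finally show "(C *\<^sub>v u) $ i = (\<mu> \<cdot>\<^sub>v u) $ i" using i by (simp add: u_def)
  qed (simp add: C_def u_def)
  ultimately have "eigenvalue C \<mu>"
    unfolding eigenvalue_def eigenvector_def by (intro exI[of _ u]) (simp add: C_def u_def)
  then have "poly (char_poly C) \<mu> = 0"
    using eigenvalue_root_char_poly[OF C] by simp
  then have "\<mu> \<in># proots (char_poly C)"
    using char_poly_neq_0[OF C] by simp
  then show ?thesis
    using proots_char_poly_constant_row_sums[of m c r, OF row] by (simp add: C_def)
qed

section \<open>The second largest eigenvalue as an entry of a sorted list\<close>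

text \<open>Count the elements that are at least \<open>b\<close>: both \<open>a\<close> and
  \<open>b\<close> qualify, but if the second entry of the decreasing list were below
  \<open>b\<close>, only its first entry could.\<close>

lemma le_second_largest:
  assumes "{#a, b#} \<subseteq># X" "b \<le> a"
  shows "b \<le> rev (sorted_list_of_multiset X) ! 1"
proof (rule ccontr)
  define xs where "xs = rev (sorted_list_of_multiset X)"
  assume "\<not> b \<le> rev (sorted_list_of_multiset X) ! 1"
  then have less: "xs ! 1 < b" by (simp add: xs_def)
  have mset: "mset xs = X" by (simp add: xs_def)
  have desc: "sorted_wrt (\<ge>) xs"
    unfolding xs_def sorted_wrt_rev using sorted_sorted_list_of_multiset[of X] by simp
  have "size {#a, b#} \<le> size X" using assms(1) by (rule size_mset_mono)
  then have "2 \<le> length xs" using mset by (metis size_mset size_add_mset size_empty numeral_2_eq_2)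
  then obtain x y ys where xs: "xs = x # y # ys"
    by (metis Suc_le_length_iff numeral_2_eq_2)
  have "filter_mset (\<lambda>z. z \<ge> b) {#a, b#} \<subseteq># filter_mset (\<lambda>z. z \<ge> b) X"
    using assms(1) by (rule multiset_filter_mono)
  moreover have "filter_mset (\<lambda>z. z \<ge> b) (mset ys) = {#}"
    using desc less xs by fastforce
  then have "filter_mset (\<lambda>z. z \<ge> b) X = (if x \<ge> b then {#x#} else {#})"
    using less unfolding mset[symmetric] xs by simp
  ultimately show False
    using assms(2) size_mset_mono by (fastforce split: if_splits)
qed

text \<open>Nonnegative entries make the row sum \<open>r\<close> dominate, as in Perron-Frobenius,
  so \<open>\<mu> \<le> r\<close>; both are roots, counted with multiplicity.\<close>

lemma second_largest_eigenvalue_ge: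
  fixes c :: "nat \<Rightarrow> nat \<Rightarrow> real"
  assumes nonneg: "\<And>i j. i < n \<Longrightarrow> j < n \<Longrightarrow> 0 \<le> c i j"
    and row: "\<And>i. i < n \<Longrightarrow> (\<Sum>j<n. c i j) = r"
    and v: "\<exists>i<n. v i \<noteq> 0" "(\<Sum>i<n. v i) = 0"
    and eig: "\<And>i. i < n \<Longrightarrow> (\<Sum>j<n. c i j * v j) = \<mu> * v i"
  shows "\<mu> \<le> second_largest_eigenvalue (mat n n (\<lambda>(i, j). c i j))"
proof -
  from v(1) obtain m where n: "n = Suc m" by (metis less_nat_zero_code not0_implies_Suc)
  have "\<mu> \<le> r"
  proof -
    \<comment> \<open>The eigenvalue equation is read at an index where \<open>v\<close> is largest
      in absolute value.\<close>
    have "Max ((\<lambda>i. \<bar>v i\<bar>) ` {..<n}) \<in> (\<lambda>i. \<bar>v i\<bar>) ` {..<n}"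
      using n by (intro Max_in) auto
    then obtain i where i: "i < n" and "Max ((\<lambda>i. \<bar>v i\<bar>) ` {..<n}) = \<bar>v i\<bar>" by auto
    then have max: "\<bar>v j\<bar> \<le> \<bar>v i\<bar>" if "j < n" for j
      using that by (metis Max_ge finite_imageI finite_lessThan imageI lessThan_iff)
    from v(1) max have pos: "\<bar>v i\<bar> > 0" by (metis abs_ge_zero abs_le_zero_iff linorder_not_le order.trans)
    have "\<mu> * \<bar>v i\<bar> \<le> \<bar>\<mu> * v i\<bar>" by (simp add: abs_mult mult_right_mono)
    also have "\<dots> = \<bar>\<Sum>j<n. c i j * v j\<bar>" by (simp add: eig i)
    also have "\<dots> \<le> (\<Sum>j<n. \<bar>c i j * v j\<bar>)" by (rule sum_abs)
    also have "\<dots> \<le> (\<Sum>j<n. c i j * \<bar>v i\<bar>)"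
      by (intro sum_mono) (auto simp: abs_mult nonneg i max intro!: mult_left_mono)
    also have "\<dots> = r * \<bar>v i\<bar>" by (simp add: sum_distrib_right[symmetric] row i)
    finally show ?thesis using pos by simp
  qed
  moreover have "{#r, \<mu>#} \<subseteq># proots (char_poly (mat n n (\<lambda>(i, j). c i j)))"
    unfolding n by (rule eigenvalue_constant_row_sums[where v = v]) (use row v eig n in auto)
  ultimately show ?thesis
    unfolding second_largest_eigenvalue_def eigenvalues_desc_def by (intro le_second_largest)
qed

text \<open>Splitting off the row sum leaves a zero block of size \<open>n - 1\<close>. The result
  serves to exclude complete bipartite graphs, whose \<open>M * transpose_mat M\<close> is
  constant.\<close>

lemma second_largest_eigenvalue_const_mat:
  fixes a :: real
  assumes "0 \<le> a" "2 \<le> n"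
  shows "second_largest_eigenvalue (mat n n (\<lambda>_. a)) = 0"
proof -
  \<comment> \<open>The zero block has size \<open>Suc m\<close>, which is at least 1, so position 1
    of the decreasing list exists and holds 0.\<close>
  define m where "m = n - 2"
  have n: "n = Suc (Suc m)" using assms(2) by (simp add: m_def)
  define Z :: "real mat" where "Z = mat (Suc m) (Suc m) (\<lambda>_. 0)"
  have "char_poly Z = (\<Prod>x\<leftarrow>diag_mat Z. [:-x, 1:])"
    by (rule char_poly_upper_triangular[of _ "Suc m"]) (auto simp: Z_def)
  also have "diag_mat Z = replicate (Suc m) 0"
    by (rule nth_equalityI) (auto simp: diag_mat_def Z_def simp del: upt_Suc replicate_Suc)
  finally have "char_poly Z = [:0, 1:] ^ Suc m"
    by (simp del: replicate_Suc power_Suc)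
  then have "proots (char_poly Z) = replicate_mset (Suc m) 0"
    by (simp add: proots_power del: power_Suc)
  then have "proots (char_poly (mat n n (\<lambda>_. a))) = add_mset (real n * a) (replicate_mset (Suc m) 0)"
    using proots_char_poly_constant_row_sums[of "Suc m" "\<lambda>_ _. a" "real n * a"]
    by (simp add: n Z_def case_prod_beta' del: sum.lessThan_Suc)
  also have "\<dots> = mset (replicate (Suc m) 0 @ [real n * a])" by simp
  finally have "sorted_list_of_multiset (proots (char_poly (mat n n (\<lambda>_. a))))
      = sort (replicate (Suc m) 0 @ [real n * a])"
    by (simp only: sorted_list_of_multiset_mset)
  also have "\<dots> = replicate (Suc m) 0 @ [real n * a]"
    using assms(1) by (intro sort_key_id_if_sorted) (simp add: sorted_append)
  finally show ?thesis
    unfolding second_largest_eigenvalue_def eigenvalues_desc_def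
    by (simp only: rev_append rev_replicate) simp
qed

section \<open>Spectral bound for zero rectangles\<close>

text \<open>The centred indicator \<open>x\<close> of \<open>X\<close> has squared norm at most
  \<open>card X\<close>. Its image \<open>y\<close> under the transposed matrix is constant on
  \<open>Y\<close>, which bounds the squared norm of \<open>y\<close> from below; the Rayleigh bound
  limits it from above.\<close>

lemma zero_rectangle_le_second_largest_eigenvalue:
  fixes m :: "nat \<Rightarrow> nat \<Rightarrow> real"
  assumes "n \<ge> 2"
    and nonneg: "\<And>i j. i < n \<Longrightarrow> j < n \<Longrightarrow> 0 \<le> m i j"
    and row: "\<And>i. i < n \<Longrightarrow> (\<Sum>j<n. m i j) = k"
    and col: "\<And>j. j < n \<Longrightarrow> (\<Sum>i<n. m i j) = k"
    and lam: "lam = second_largest_eigenvalue (mat n n (\<lambda>(i, j). \<Sum>l<n. m i l * m j l))" "0 \<le> lam"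
    and XY: "X \<subseteq> {..<n}" "Y \<subseteq> {..<n}"
    and zero: "\<And>i j. i \<in> X \<Longrightarrow> j \<in> Y \<Longrightarrow> m i j = 0"
  shows "k\<^sup>2 * (real (card X) * real (card Y)) \<le> lam * (real n)\<^sup>2"
proof -
  define c where "c i j = (\<Sum>l<n. m i l * m j l)" for i j
  have c_row: "(\<Sum>j<n. c i j) = k\<^sup>2" if "i < n" for i
  proof -
    have "(\<Sum>j<n. c i j) = (\<Sum>l<n. m i l * (\<Sum>j<n. m j l))"
      unfolding c_def by (subst sum.swap) (simp add: sum_distrib_left)
    also have "\<dots> = (\<Sum>l<n. m i l * k)" by (intro sum.cong) (simp_all add: col)
    also have "\<dots> = k\<^sup>2"
      using that by (simp add: sum_distrib_right[symmetric] row power2_eq_square)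
    finally show ?thesis .
  qed
  have c_sym: "c i j = c j i" for i j
    by (simp add: c_def mult.commute)
  obtain \<mu> v where v: "\<exists>i<n. v i \<noteq> 0" "(\<Sum>i<n. v i) = 0"
    and eig: "\<And>i. i < n \<Longrightarrow> (\<Sum>j<n. c i j * v j) = \<mu> * v i"
    and max: "\<And>x. (\<Sum>i<n. x i) = 0 \<Longrightarrow>
      (\<Sum>i<n. \<Sum>j<n. c i j * x i * x j) \<le> \<mu> * (\<Sum>i<n. (x i)\<^sup>2)"
    by (rule sum_0_Rayleigh_maximizer[OF assms(1), of c, OF c_sym c_row]) (assumption, rule that)
  have "\<mu> \<le> lam"
    unfolding lam(1) c_def[symmetric]
    by (rule second_largest_eigenvalue_ge[OF _ c_row v eig])
      (auto simp: c_def nonneg intro!: sum_nonneg)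
  \<comment> \<open>The density of \<open>X\<close>; subtracting it makes the sum of
    \<open>x\<close> zero.\<close>
  define p where "p = real (card X) / real n"
  define x where "x i = (if i \<in> X then 1 else 0) - p" for i
  define y where "y l = (\<Sum>i<n. m i l * x i)" for l
  have n: "real n > 0" using assms(1) by simp
  have Int: "{..<n} \<inter> X = X" "{..<n} \<inter> {i. i \<in> X} = X" using XY by auto
  have x_sum: "(\<Sum>i<n. x i) = 0"
    using n by (simp add: x_def sum_subtractf sum.If_cases Int p_def)
  have "(\<Sum>i<n. (x i)\<^sup>2) = (\<Sum>i<n. (1 - 2 * p) * (if i \<in> X then 1 else 0) + p\<^sup>2)"
    by (intro sum.cong) (auto simp: x_def power2_eq_square algebra_simps)
  also have "\<dots> = (1 - 2 * p) * real (card X) + real n * p\<^sup>2"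
    by (simp add: sum.distrib sum_distrib_left[symmetric] sum.If_cases Int)
  also have "\<dots> = real (card X) - p * real (card X)"
    using n by (simp add: p_def power2_eq_square field_simps)
  also have "\<dots> \<le> real (card X)" by (simp add: p_def)
  finally have x_norm: "(\<Sum>i<n. (x i)\<^sup>2) \<le> real (card X)" .
  have y: "y l = - k * p" if "l \<in> Y" for l
  proof -
    \<comment> \<open>The column of \<open>l\<close> vanishes on \<open>X\<close>, so only the mean
      contributes.\<close>
    have "y l = (\<Sum>i<n. - p * m i l)"
      unfolding y_def by (intro sum.cong) (auto simp: x_def zero that)
    also have "\<dots> = - k * p"
      using that XY by (subst sum_distrib_left[symmetric]) (auto simp: col)
    finally show ?thesis .
  qed
  have "real (card Y) * (k * p)\<^sup>2 = (\<Sum>l\<in>Y. (y l)\<^sup>2)"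
    by (simp add: y)
  also have "\<dots> \<le> (\<Sum>l<n. (y l)\<^sup>2)"
    using XY by (intro sum_mono2) auto
  also have "\<dots> = (\<Sum>l<n. \<Sum>i<n. \<Sum>j<n. m i l * m j l * x i * x j)"
    by (simp add: y_def power2_eq_square sum_product mult_ac)
  also have "\<dots> = (\<Sum>i<n. \<Sum>l<n. \<Sum>j<n. m i l * m j l * x i * x j)"
    by (rule sum.swap)
  also have "\<dots> = (\<Sum>i<n. \<Sum>j<n. \<Sum>l<n. m i l * m j l * x i * x j)"
    by (intro sum.cong refl sum.swap)
  also have "\<dots> = (\<Sum>i<n. \<Sum>j<n. c i j * x i * x j)"
    by (simp add: c_def sum_distrib_right)
  also have "\<dots> \<le> \<mu> * (\<Sum>i<n. (x i)\<^sup>2)" by (rule max[OF x_sum])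
  also have "\<dots> \<le> lam * (\<Sum>i<n. (x i)\<^sup>2)"
    using \<open>\<mu> \<le> lam\<close> by (intro mult_right_mono sum_nonneg) auto
  also have "\<dots> \<le> lam * real (card X)"
    using x_norm lam(2) by (rule mult_left_mono)
  finally have *: "real (card Y) * (k * p)\<^sup>2 \<le> lam * real (card X)" .
  \<comment> \<open>A factor \<open>card X\<close> is cancelled, so empty \<open>X\<close> is
    treated apart, using \<open>0 \<le> lam\<close>.\<close>
  show ?thesis
  proof (cases "card X = 0")
    case False
    have "(k\<^sup>2 * (real (card X) * real (card Y))) * real (card X)
        = real (card Y) * (k * p)\<^sup>2 * (real n)\<^sup>2"
      using n by (simp add: p_def power2_eq_square field_simps)
    also have "\<dots> \<le> lam * real (card X) * (real n)\<^sup>2"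
      using * by (rule mult_right_mono) simp
    finally have "(k\<^sup>2 * (real (card X) * real (card Y))) * real (card X)
        \<le> (lam * (real n)\<^sup>2) * real (card X)" by (simp add: mult_ac)
    then show ?thesis using False by (simp add: mult_ac)
  qed (use lam in simp)
qed

section \<open>Staircases and interval covers\<close>

lemma sum_inverse_sqrt_le: "(\<Sum>i<d. 1 / sqrt (real (Suc i))) \<le> 2 * sqrt (real d)"
proof (induction d)
  case (Suc d)
  define x y where "x = sqrt (real (Suc d))" and "y = sqrt (real d)"
  have x: "x > 0" and "x\<^sup>2 = y\<^sup>2 + 1" by (simp_all add: x_def y_def)
  \<comment> \<open>The right side equals \<open>(x\<^sup>2 - y\<^sup>2) + (x - y)\<^sup>2\<close>,
    whose first part is 1. Dividing by \<open>x\<close> gives a bound that telescopes.\<close>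
  then have "1 \<le> 2 * (x - y) * x"
    using zero_le_power2[of "x - y"] by (simp add: power2_eq_square algebra_simps)
  then have "1 / x \<le> 2 * (x - y)" using x by (simp add: divide_le_eq)
  with Suc show ?case by (simp add: x_def y_def)
qed simp

text \<open>The rows \<open>Y a\<close> shrink as \<open>f a\<close> grows, so each row spans a
  rectangle inside \<open>R\<close> with all rows before it. Its length is bounded by the geometric
  mean of the degree bound and the rectangle bound.\<close>

lemma card_staircase_le:
  fixes f :: "'a \<Rightarrow> real" and g :: "'b \<Rightarrow> real"
  assumes fin: "finite A" "finite B"
    and degA: "\<And>a. a \<in> A \<Longrightarrow> card {b \<in> B. (a, b) \<in> R} \<le> d"
    and degB: "\<And>b. b \<in> B \<Longrightarrow> card {a \<in> A. (a, b) \<in> R} \<le> d"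
    and sub: "\<And>a b. a \<in> A \<Longrightarrow> b \<in> B \<Longrightarrow> f a < g b \<Longrightarrow> (a, b) \<in> R"
    and rect: "\<And>X Y. X \<subseteq> A \<Longrightarrow> Y \<subseteq> B \<Longrightarrow> X \<times> Y \<subseteq> R \<Longrightarrow> real (card X) * real (card Y) \<le> s\<^sup>2"
    and s: "0 \<le> s"
  shows "real (card {(a, b) \<in> A \<times> B. f a < g b}) \<le> 2 * s * real d"
proof -
  obtain zs where zs: "set zs = A" "distinct zs"
    using finite_distinct_list[OF fin(1)] by blast
  define xs where "xs = sort_key f zs"
  define n where "n = length xs"
  have xs: "set xs = A" "distinct xs" "sorted (map f xs)"
    using zs by (simp_all add: xs_def)
  define Y where "Y a = {b \<in> B. f a < g b}" for a
  have Y: "Y a \<subseteq> B" "finite (Y a)" for a using fin by (auto simp: Y_def)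
  \<comment> \<open>Indices start at 0, so row \<open>i\<close> lies in a rectangle of
    \<open>Suc i\<close> rows.\<close>
  have row: "real (card (Y (xs ! i))) \<le> (if i < d then s * sqrt (real d) * (1 / sqrt (real (Suc i))) else 0)"
    if i: "i < n" for i
  proof (cases "Y (xs ! i) = {}")
    case True
    then show ?thesis using s by simp
  next
    case False
    define X where "X = set (take (Suc i) xs)"
    have XA: "X \<subseteq> A" using xs(1) set_take_subset by (force simp: X_def)
    have cX: "card X = Suc i"
      using xs(2) i by (simp add: X_def distinct_card n_def)
    have "f a \<le> f (xs ! i)" if "a \<in> X" for a
    proof -
      obtain j where j: "j < length (take (Suc i) xs)" "take (Suc i) xs ! j = a"
        using \<open>a \<in> X\<close> unfolding X_def in_set_conv_nth by blast
      then have "j \<le> i" by simp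
      with j have "a = xs ! j" by simp
      with \<open>j \<le> i\<close> show ?thesis
        using sorted_nth_mono[OF xs(3) \<open>j \<le> i\<close>] i by (simp add: n_def)
    qed
    then have XY: "X \<times> Y (xs ! i) \<subseteq> R"
      using XA sub by (force simp: Y_def)
    \<comment> \<open>Any column that meets row \<open>i\<close> has at least \<open>Suc i\<close>
      elements of \<open>R\<close>, which forces \<open>i < d\<close>.\<close>
    obtain b where b: "b \<in> Y (xs ! i)" using False by blast
    have "X \<subseteq> {a \<in> A. (a, b) \<in> R}" using XA XY b by auto
    then have "Suc i \<le> card {a \<in> A. (a, b) \<in> R}"
      unfolding cX[symmetric] by (intro card_mono) (use fin in auto)
    also have "\<dots> \<le> d" using b Y by (intro degB) auto
    finally have "i < d" by simp
    define y where "y = real (card (Y (xs ! i)))"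
    have "xs ! i \<in> A" using i xs(1) by (auto simp: n_def)
    then have "card (Y (xs ! i)) \<le> card {b \<in> B. (xs ! i, b) \<in> R}"
      using fin sub by (intro card_mono) (auto simp: Y_def)
    then have "y \<le> d" using degA[OF \<open>xs ! i \<in> A\<close>] by (simp add: y_def)
    moreover have "real (Suc i) * y \<le> s\<^sup>2"
      using rect[OF XA Y(1) XY] by (simp add: cX y_def)
    \<comment> \<open>Multiplying the two bounds on \<open>y\<close> yields their geometric
      mean.\<close>
    ultimately have "(real (Suc i) * y) * y \<le> s\<^sup>2 * real d"
      by (intro mult_mono) (auto simp: y_def)
    then have "y\<^sup>2 \<le> s\<^sup>2 * real d / real (Suc i)"
      by (simp add: le_divide_eq power2_eq_square mult_ac)
    then have "y \<le> sqrt (s\<^sup>2 * real d / real (Suc i))" by (rule real_le_rsqrt)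
    also have "\<dots> = s * sqrt (real d) * (1 / sqrt (real (Suc i)))"
      using s by (simp add: real_sqrt_mult real_sqrt_divide)
    finally show ?thesis using \<open>i < d\<close> by (simp add: y_def)
  qed
  have "{(a, b) \<in> A \<times> B. f a < g b} = Sigma A Y" by (auto simp: Y_def)
  then have "real (card {(a, b) \<in> A \<times> B. f a < g b}) = (\<Sum>a\<in>A. real (card (Y a)))"
    using fin Y by (simp add: card_SigmaI)
  also have "\<dots> = (\<Sum>i<n. real (card (Y (xs ! i))))"
    by (rule sum.reindex_bij_betw[symmetric]) (use xs in \<open>simp add: bij_betw_nth n_def\<close>)
  also have "\<dots> \<le> (\<Sum>i<n. if i < d then s * sqrt (real d) * (1 / sqrt (real (Suc i))) else 0)"
    by (intro sum_mono row) simp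
  also have "\<dots> = (\<Sum>i\<in>{..<n} \<inter> {..<d}. s * sqrt (real d) * (1 / sqrt (real (Suc i))))"
    by (simp add: sum.If_cases lessThan_def)
  also have "\<dots> \<le> (\<Sum>i<d. s * sqrt (real d) * (1 / sqrt (real (Suc i))))"
    by (intro sum_mono2) (use s in auto)
  also have "\<dots> = s * sqrt (real d) * (\<Sum>i<d. 1 / sqrt (real (Suc i)))"
    by (rule sum_distrib_left[symmetric])
  also have "\<dots> \<le> s * sqrt (real d) * (2 * sqrt (real d))"
    by (intro mult_left_mono sum_inverse_sqrt_le) (use s in simp)
  also have "\<dots> = 2 * s * real d" by simp
  finally show ?thesis .
qed

section \<open>Regular bipartite graphs and the bound on boxicity\<close>

lemma regular_bipartition_degree:
  assumes "pair_graph G" "bipartition G A B" "regular G k"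
  shows "a \<in> A \<Longrightarrow> card {b \<in> B. (a, b) \<in> parcs G} = k"
    and "b \<in> B \<Longrightarrow> card {a \<in> A. (a, b) \<in> parcs G} = k"
proof -
  interpret pair_graph G by fact
  have deg: "card {v. (u, v) \<in> parcs G} = k" if "u \<in> pverts G" for u
  proof -
    have "out_arcs (with_proj G) u = Pair u ` {v. (u, v) \<in> parcs G}"
      by (auto simp: out_arcs_def)
    then have "out_degree (with_proj G) u = card {v. (u, v) \<in> parcs G}"
      by (simp add: out_degree_def card_image inj_on_def)
    then show ?thesis using assms(3) that by (simp add: regular_def)
  qed
  have AB: "A \<union> B = pverts G" "A \<inter> B = {}" "parcs G \<subseteq> A \<times> B \<union> B \<times> A"
    using assms(2) by (auto simp: bipartition_def)
  show "card {b \<in> B. (a, b) \<in> parcs G} = k" if "a \<in> A"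
  proof -
    have "{b \<in> B. (a, b) \<in> parcs G} = {b. (a, b) \<in> parcs G}" using AB that by auto
    then show ?thesis using deg[of a] AB that by auto
  qed
  show "card {a \<in> A. (a, b) \<in> parcs G} = k" if "b \<in> B"
  proof -
    \<comment> \<open>\<open>out_degree\<close> counts arcs leaving \<open>b\<close>, so the arcs
      are reversed by symmetry.\<close>
    have "{a \<in> A. (a, b) \<in> parcs G} = {a. (b, a) \<in> parcs G}"
      using AB that arcs_symmetric by auto
    then show ?thesis using deg[of b] AB that by auto
  qed
qed

theorem theorem13:
  fixes G :: "'a pair_pre_digraph" and A B :: "'a set" and as bs :: "'a list"
    and n k :: nat and M :: "real mat" and lam :: real
  assumes "pair_graph G"
    and "bipartition G A B"
    and "card A = n" and "card B = n"
    and "n \<ge> 2"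
    and "regular G k"
    and "distinct as" and "set as = A"
    and "distinct bs" and "set bs = B"
    and "M = bip_incidence_mat G as bs"
    and "lam = second_largest_eigenvalue (M * transpose_mat M)"
    and "lam \<noteq> 0"
  shows "real (boxicity G) \<ge> real k / (4 * sqrt lam)"
proof (cases "lam > 0 \<and> k > 0")
  case False
  \<comment> \<open>The real \<open>sqrt\<close> is odd, so it is nonpositive for negative
    \<open>lam\<close>.\<close>
  then have "real k / (4 * sqrt lam) \<le> 0"
    by (cases "k = 0") (auto intro!: divide_nonneg_nonpos)
  then show ?thesis by (rule order.trans) simp
next
  case True
  then have lam: "lam > 0" and k: "k > 0" by auto
  have bip: "A \<union> B = pverts G" "A \<inter> B = {}"
    using assms(2) by (auto simp: bipartition_def)
  have fin: "finite A" "finite B" using assms by auto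
  have lenA: "length as = n" and lenB: "length bs = n"
    using assms distinct_card by fastforce+
  have bijA: "bij_betw ((!) as) {..<n} A" and bijB: "bij_betw ((!) bs) {..<n} B"
    using assms lenA lenB by (simp_all add: bij_betw_nth)
  note degree = regular_bipartition_degree[OF assms(1,2,6)]
  define m :: "nat \<Rightarrow> nat \<Rightarrow> real"
    where "m i j = (if (as ! i, bs ! j) \<in> parcs G then 1 else 0)" for i j
  have MMT: "M * transpose_mat M = mat n n (\<lambda>(i, j). \<Sum>l<n. m i l * m j l)"
    unfolding assms(11) bip_incidence_mat_def lenA lenB
    by (rule eq_matI) (auto simp: scalar_prod_def atLeast0LessThan m_def)
  have row: "(\<Sum>j<n. m i j) = real k" if "i < n" for i
  proof -
    have a: "as ! i \<in> A" using that assms(8) lenA by auto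
    have "(\<Sum>j<n. m i j) = (\<Sum>b\<in>B. if (as ! i, b) \<in> parcs G then 1 else 0)"
      unfolding m_def by (rule sum.reindex_bij_betw[OF bijB])
    also have "\<dots> = real (card {b \<in> B. (as ! i, b) \<in> parcs G})"
      using fin by (simp add: sum.If_cases Int_def)
    finally show ?thesis by (simp add: degree(1)[OF a])
  qed
  have col: "(\<Sum>i<n. m i j) = real k" if "j < n" for j
  proof -
    have b: "bs ! j \<in> B" using that assms(10) lenB by auto
    have "(\<Sum>i<n. m i j) = (\<Sum>a\<in>A. if (a, bs ! j) \<in> parcs G then 1 else 0)"
      unfolding m_def by (rule sum.reindex_bij_betw[OF bijA])
    also have "\<dots> = real (card {a \<in> A. (a, bs ! j) \<in> parcs G})"
      using fin by (simp add: sum.If_cases Int_def)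
    finally show ?thesis by (simp add: degree(2)[OF b])
  qed
  define R where "R = {(a, b) \<in> A \<times> B. (a, b) \<notin> parcs G}"
  define d where "d = n - k"
  \<comment> \<open>Chosen so that the spectral bound on zero rectangles reads
    \<open>card X * card Y \<le> s\<^sup>2\<close>.\<close>
  define s where "s = real n * sqrt lam / real k"
  have s: "s \<ge> 0" using lam by (simp add: s_def)
  have degA: "card {b \<in> B. (a, b) \<in> R} = d" if "a \<in> A" for a
  proof -
    have "{b \<in> B. (a, b) \<in> R} = B - {b \<in> B. (a, b) \<in> parcs G}" using that by (auto simp: R_def)
    then show ?thesis
      using fin by (simp add: card_Diff_subset degree(1)[OF that] d_def assms(4))
  qed
  have degB: "card {a \<in> A. (a, b) \<in> R} = d" if "b \<in> B" for b
  proof -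
    have "{a \<in> A. (a, b) \<in> R} = A - {a \<in> A. (a, b) \<in> parcs G}" using that by (auto simp: R_def)
    then show ?thesis
      using fin by (simp add: card_Diff_subset degree(2)[OF that] d_def assms(3))
  qed
  have rect: "real (card X) * real (card Y) \<le> s\<^sup>2" if XY: "X \<subseteq> A" "Y \<subseteq> B" "X \<times> Y \<subseteq> R" for X Y
  proof -
    define X' Y' where "X' = {i. i < n \<and> as ! i \<in> X}" and "Y' = {j. j < n \<and> bs ! j \<in> Y}"
    have "(!) as ` X' = X" "(!) bs ` Y' = Y"
      using XY bijA bijB by (force simp: X'_def Y'_def bij_betw_def)+
    moreover have "X' \<subseteq> {..<n}" "Y' \<subseteq> {..<n}" by (auto simp: X'_def Y'_def)
    moreover from this have "inj_on ((!) as) X'" "inj_on ((!) bs) Y'"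
      using bijA bijB by (auto simp: bij_betw_def intro: inj_on_subset)
    ultimately have card: "card X' = card X" "card Y' = card Y"
      using card_image by metis+
    have "(real k)\<^sup>2 * (real (card X') * real (card Y')) \<le> lam * (real n)\<^sup>2"
    proof (rule zero_rectangle_le_second_largest_eigenvalue[OF assms(5) _ row col])
      show "m i j = 0" if "i \<in> X'" "j \<in> Y'" for i j
        using that XY(3) by (auto simp: X'_def Y'_def m_def R_def)
    qed (use lam assms(12) MMT in \<open>auto simp: m_def X'_def Y'_def\<close>)
    then show ?thesis
      using k lam by (simp add: card s_def power_divide power_mult_distrib le_divide_eq mult_ac)
  qed
  have cardR: "card R = n * d"
  proof -
    have "R = Sigma A (\<lambda>a. {b \<in> B. (a, b) \<in> R})" by (auto simp: R_def)
    then have "card R = (\<Sum>a\<in>A. card {b \<in> B. (a, b) \<in> R})"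
      using fin card_SigmaI[of A "\<lambda>a. {b \<in> B. (a, b) \<in> R}"] by simp
    then show ?thesis by (simp add: degA assms(3))
  qed
  \<comment> \<open>If \<open>d = 0\<close>, the graph is complete bipartite and \<open>lam\<close>
    would be 0. Positivity lets \<open>d\<close> be cancelled at the end.\<close>
  have "d > 0"
  proof (rule ccontr)
    assume "\<not> d > 0"
    moreover have "finite R" using fin by (auto simp: R_def intro: finite_subset[of _ "A \<times> B"])
    ultimately have "R = {}" using cardR by simp
    then have "m i j = 1" if "i < n" "j < n" for i j
      using that bijA bijB by (fastforce simp: m_def R_def bij_betw_def)
    then have "M * transpose_mat M = mat n n (\<lambda>_. real n)"
      unfolding MMT by (intro eq_matI) auto
    then have "lam = 0"
      using second_largest_eigenvalue_const_mat[of "real n" n] assms(5,12) by simp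
    with lam show False by simp
  qed
  define t where "t = boxicity G"
  obtain I where "interval_cover G t I"
    using LeastI_ex[OF interval_cover_exists[OF assms(1)]] unfolding t_def boxicity_def by blast
  then have I: "\<And>i. i < t \<Longrightarrow> interval_graph (I i) \<and> pverts (I i) = pverts G"
    and cover: "parcs G = {(u, v). u \<in> pverts G \<and> v \<in> pverts G \<and> u \<noteq> v} \<inter> (\<Inter>i<t. parcs (I i))"
    by (auto simp: interval_cover_def)
  \<comment> \<open>Two nonempty closed intervals are disjoint exactly when one ends before the
    other begins, so each interval graph yields two staircases.\<close>
  have "\<exists>l r :: 'a \<Rightarrow> real. \<forall>u \<in> pverts G. \<forall>v \<in> pverts G. u \<noteq> v \<longrightarrow>
      ((u, v) \<notin> parcs (I i) \<longleftrightarrow> r u < l v \<or> r v < l u)" if i: "i < t" for i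
  proof -
    obtain l r :: "'a \<Rightarrow> real" where lr: "\<forall>v \<in> pverts G. l v \<le> r v"
      "\<And>u v. (u, v) \<in> parcs (I i) \<longleftrightarrow>
         u \<in> pverts G \<and> v \<in> pverts G \<and> u \<noteq> v \<and> {l u..r u} \<inter> {l v..r v} \<noteq> {}"
      using I[OF i] unfolding interval_graph_def by metis
    show ?thesis
      by (rule exI[of _ l], rule exI[of _ r]) (use lr in \<open>auto simp: not_le\<close>)
  qed
  then obtain l r :: "nat \<Rightarrow> 'a \<Rightarrow> real" where lr:
    "\<And>i u v. i < t \<Longrightarrow> u \<in> pverts G \<Longrightarrow> v \<in> pverts G \<Longrightarrow> u \<noteq> v \<Longrightarrow>
      (u, v) \<notin> parcs (I i) \<longleftrightarrow> r i u < l i v \<or> r i v < l i u"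
    by metis
  \<comment> \<open>Negating both sides of \<open>r i b < l i a\<close> brings the second order into
    the form \<open>f a < g b\<close>, so one staircase lemma covers both.\<close>
  have R_iff: "(a, b) \<in> R \<longleftrightarrow> (\<exists>i<t. r i a < l i b \<or> - l i a < - r i b)" if "a \<in> A" "b \<in> B" for a b
  proof -
    have "a \<in> pverts G" "b \<in> pverts G" "a \<noteq> b" using that bip by auto
    then show ?thesis using that lr by (auto simp: R_def cover)
  qed
  have "R \<subseteq> (\<Union>i<t. {(a, b) \<in> A \<times> B. r i a < l i b} \<union> {(a, b) \<in> A \<times> B. - l i a < - r i b})"
  proof
    fix e assume e: "e \<in> R"
    then obtain a b where "e = (a, b)" "a \<in> A" "b \<in> B" by (auto simp: R_def)
    then show "e \<in> (\<Union>i<t. {(a, b) \<in> A \<times> B. r i a < l i b} \<union> {(a, b) \<in> A \<times> B. - l i a < - r i b})"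
      using R_iff e by auto
  qed
  moreover have finU: "finite {(a, b) \<in> A \<times> B. f a < (g b :: real)}" for f g
    using fin by (auto intro: finite_subset[of _ "A \<times> B"])
  ultimately have "card R \<le> card (\<Union>i<t. {(a, b) \<in> A \<times> B. r i a < l i b} \<union> {(a, b) \<in> A \<times> B. - l i a < - r i b})"
    by (intro card_mono finite_UN_I finite_UnI finU finite_lessThan)
  also have "\<dots> \<le> (\<Sum>i<t. card ({(a, b) \<in> A \<times> B. r i a < l i b} \<union> {(a, b) \<in> A \<times> B. - l i a < - r i b}))"
    by (rule card_UN_le) simp
  also have "\<dots> \<le> (\<Sum>i<t. card {(a, b) \<in> A \<times> B. r i a < l i b} + card {(a, b) \<in> A \<times> B. - l i a < - r i b})"
    by (intro sum_mono card_Un_le)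
  finally have "real (card R) \<le> real \<dots>" by (simp only: of_nat_le_iff)
  also have "\<dots> = (\<Sum>i<t. real (card {(a, b) \<in> A \<times> B. r i a < l i b})
      + real (card {(a, b) \<in> A \<times> B. - l i a < - r i b}))"
    by (simp only: of_nat_sum of_nat_add)
  also have "\<dots> \<le> (\<Sum>i<t. 2 * s * real d + 2 * s * real d)"
  proof (intro sum_mono add_mono)
    fix i assume "i \<in> {..<t}"
    then have "i < t" by simp
    show "real (card {(a, b) \<in> A \<times> B. r i a < l i b}) \<le> 2 * s * real d"
      by (rule card_staircase_le[OF fin _ _ _ rect s]) (use \<open>i < t\<close> R_iff degA degB in auto)
    show "real (card {(a, b) \<in> A \<times> B. - l i a < - r i b}) \<le> 2 * s * real d"
      by (rule card_staircase_le[OF fin _ _ _ rect s]) (use \<open>i < t\<close> R_iff degA degB in auto)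
  qed
  also have "\<dots> = (4 * real t * s) * real d" by simp
  finally have "real n * real d \<le> (4 * real t * s) * real d" by (simp add: cardR)
  \<comment> \<open>Both the number \<open>n * d\<close> of non-edges and the staircase bounds carry
    the factor \<open>d\<close>, which cancels.\<close>
  then have "real n \<le> 4 * real t * s"
    using \<open>d > 0\<close> by simp
  then have "real n * real k \<le> real n * (4 * real t * sqrt lam)"
    using k by (simp add: s_def le_divide_eq mult_ac)
  then have "real k \<le> 4 * real t * sqrt lam"
    using assms(5) by simp
  then show ?thesis
    using lam by (simp add: t_def divide_le_eq mult_ac)
qed

end
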